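(* Let $T>0$, $r\ge 0$ and $g:\mathcal I\to\mathbb R$. There exists a unique family $(V^{T,r}_i)_{i\in\mathcal I}$ of continuously differentiable functions $V^{T,r}_i:(-\infty,T]\to\mathbb R$ such that $$\frac{d}{dt}V^{T,r}_i(t)-rV^{T,r}_i(t)+H\Big(i,\big(V^{T,r}_j(t)-V^{T,r}_i(t)\big)_{j\in\mathcal V(i)}\Big)=0,\qquad \forall (i,t)\in\mathcal I\times(-\infty,T],$$ with terminal condition $V^{T,r}_i(T)=g(i)$ for all $i\in\mathcal I$.
   Context: $\mathcal I=\{1,\dots,N\}$ is the set of nodes of a finite strongly connected directed graph $\mathcal G$ (for any two nodes $i,j$ there is a directed path from $i$ to $j$). For $i\in\mathcal I$, $\mathcal V(i)\subset\mathcal I\setminus\{i\}$ is the set of nodes $j$ for which there is a directed edge from $i$ to $j$. $\mathbb R_+=[0,\infty)$, $\mathbb R_+^*=(0,\infty)$. For each $i\in\mathcal I$ a cost function $L(i,\cdot):\mathbb R_+^{|\mathcal V(i)|}\to\mathbb R\cup\{+\infty\}$ is given, with: (A1) for every $i$ there is a tuple $(\lambda_{ij})_{j\in\mathcal V(i)}$ with all entries in $\mathbb R_+^*$ such that $L(i,(\lambda_{ij})_j)<+\infty$; (A2) each $L(i,\cdot)$ is lower semi-continuous; (A3) there is $\underline C\in\mathbb R$ with $L(i,\lambda)\ge\underline C$ for all $i$ and all $\lambda\in\mathbb R_+^{|\mathcal V(i)|}$; (A4) for every $i$, $L(i,\lambda)/\|\lambda\|_\infty\to+\infty$ as $\|\lambda\|_\infty\to+\infty$.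 The Hamiltonian functions are $H(i,p)=\sup_{\lambda\in\mathbb R_+^{|\mathcal V(i)|}}\big(\sum_{j\in\mathcal V(i)}\lambda_{j}p_j-L(i,\lambda)\big)$ for $p\in\mathbb R^{|\mathcal V(i)|}$; they are real-valued. At $t=T$ the derivative is one-sided. *)

theory Defs
  imports "HOL-Analysis.Analysis" "Graph_Theory.Digraph_Component"
begin

definition out_nbrs :: "(nat, 'e) pre_digraph \<Rightarrow> nat \<Rightarrow> nat set" where
  "out_nbrs G i = {j. i \<rightarrow>\<^bsub>G\<^esub> j}"

text \<open>A tuple indexed by a finite set \<open>J\<close> is a function that is \<open>undefined\<close> outside \<open>J\<close>.
  On these functions the product topology is the usual topology of \<open>[0,\<infinity>)\<close> to the power \<open>J\<close>.\<close>

definition nonneg_tuples :: "nat set \<Rightarrow> (nat \<Rightarrow> real) set" where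
  "nonneg_tuples J = (\<Pi>\<^sub>E j\<in>J. {0..})"

definition nonneg_topology :: "nat set \<Rightarrow> (nat \<Rightarrow> real) topology" where
  "nonneg_topology J = product_topology (\<lambda>_. top_of_set {0..}) J"

lemma topspace_nonneg_topology [simp]: "topspace (nonneg_topology J) = nonneg_tuples J"
  by (simp add: nonneg_topology_def nonneg_tuples_def)

definition lower_semicontinuous_map :: "'a topology \<Rightarrow> ('a \<Rightarrow> ereal) \<Rightarrow> bool" where
  "lower_semicontinuous_map X f \<longleftrightarrow> (\<forall>a. openin X {x \<in> topspace X. a < f x})"

text \<open>The element \<open>0\<close> only serves to make the norm of the empty tuple zero.\<close>

definition sup_norm :: "nat set \<Rightarrow> (nat \<Rightarrow> real) \<Rightarrow> real" where
  "sup_norm J x = Max (insert 0 ((\<lambda>j. \<bar>x j\<bar>) ` J))"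

text \<open>The supremum is taken in the extended reals, so that it is meaningful without first
  knowing that it is finite.\<close>

definition hamiltonian ::
  "(nat, 'e) pre_digraph \<Rightarrow> (nat \<Rightarrow> (nat \<Rightarrow> real) \<Rightarrow> ereal) \<Rightarrow> nat \<Rightarrow> (nat \<Rightarrow> real) \<Rightarrow> ereal" where
  "hamiltonian G L i p =
     (SUP l \<in> nonneg_tuples (out_nbrs G i). ereal (\<Sum>j\<in>out_nbrs G i. l j * p j) - L i l)"

text \<open>Continuously differentiable solutions of the terminal value problem. The filter
  \<open>at t within {..T}\<close> gives the two-sided derivative for \<open>t < T\<close> and the left derivative at \<open>T\<close>;
  \<open>D\<close> is the derivative of the \<open>i\<close>-th component. An equation in the extended reals with a
  real first summand also forces the Hamiltonian to be finite.\<close>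

definition HJ_solution ::
  "(nat, 'e) pre_digraph \<Rightarrow> (nat \<Rightarrow> (nat \<Rightarrow> real) \<Rightarrow> ereal) \<Rightarrow> real \<Rightarrow> real \<Rightarrow> (nat \<Rightarrow> real)
     \<Rightarrow> (nat \<Rightarrow> real \<Rightarrow> real) \<Rightarrow> bool" where
  "HJ_solution G L T r g V \<longleftrightarrow>
     (\<forall>i \<in> verts G.
        (\<exists>D. continuous_on {..T} D \<and>
             (\<forall>t\<le>T. (V i has_real_derivative D t) (at t within {..T}) \<and>
                ereal (D t - r * V i t)
                  + hamiltonian G L i (\<lambda>j\<in>out_nbrs G i. V j t - V i t) = 0)) \<and>
        V i T = g i)"

end

theory Submission
  imports Defs "HOL-Probability.Discrete_Topology"
begin

text \<open>The Hamiltonians are finite, nondecreasing in every argument and, by superlinear growth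
  of the costs, locally Lipschitz. At a node \<open>i\<close> where \<open>V i t\<close> is maximal, all differences
  \<open>V j t - V i t\<close> are nonpositive, so monotonicity gives a maximum principle for the system. The
  maximum principle yields uniqueness without any Lipschitz estimate. It also yields a bound, linear
  in \<open>T - t\<close>, for the system in which the differences are clamped to \<open>[-M, M]\<close>. The clamped
  system is globally Lipschitz and hence globally solvable, and by the bound its solution solves the
  original system on \<open>[a, T]\<close> once \<open>M\<close> is large; letting \<open>a\<close> tend to minus infinity and gluing
  gives existence.\<close>

subsection \<open>Globally Lipschitz systems\<close>

lemma integral_has_real_derivative_atLeast:
  fixes F :: "real \<Rightarrow> real"
  assumes "continuous_on {a..} F" "a \<le> t"
  shows "((\<lambda>x. integral {a..x} F) has_real_derivative F t) (at t within {a..})"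
proof -
  have "((\<lambda>x. integral {a..x} F) has_real_derivative F t) (at t within {a..t+1})"
    by (rule integral_has_real_derivative) (use assms in \<open>auto intro: continuous_on_subset\<close>)
  moreover have "at t within {a..t+1} = at t within {a..}"
    by (rule at_within_nhd[of _ "{..<t+1}"]) auto
  ultimately show ?thesis by simp
qed

text \<open>Singletons are open in the discrete factor, so the preimage of an open set is a union of
  open slices, one for each index.\<close>

lemma continuous_on_discrete_times:
  fixes f :: "'i discrete \<times> 'a::topological_space \<Rightarrow> 'b::topological_space"
  assumes "\<And>i. continuous_on UNIV (\<lambda>s. f (i, s))"
  shows "continuous_on UNIV f"
proof (subst continuous_on_open_vimage[OF open_UNIV], intro allI impI)
  fix B :: "'b set" assume "open B"
  have "f -` B \<inter> UNIV = (\<Union>i. {i} \<times> ((\<lambda>s. f (i, s)) -` B \<inter> UNIV))" by auto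
  moreover have "open ((\<lambda>s. f (i, s)) -` B \<inter> UNIV)" for i
    using assms[of i] \<open>open B\<close> by (subst (asm) continuous_on_open_vimage) auto
  ultimately show "open (f -` B \<inter> UNIV)"
    by (simp add: open_UN open_Times Discrete_Topology.open_discrete)
qed

text \<open>Lipschitz continuity on cubes for the maximum norm. Letting \<open>d\<close> bound the
  norm of the difference avoids a maximum over a possibly empty \<open>J\<close>. For finite
  \<open>J\<close>, the choice \<open>d = 0\<close> shows that \<open>F\<close> reads only the
  coordinates in \<open>J\<close>.\<close>

definition locally_lipschitz_in :: "'i set \<Rightarrow> (('i \<Rightarrow> real) \<Rightarrow> real) \<Rightarrow> bool" where
  "locally_lipschitz_in J F \<longleftrightarrow> (\<forall>M. \<exists>K\<ge>0. \<forall>p q d. 0 \<le> d \<longrightarrow>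
     (\<forall>j\<in>J. \<bar>p j\<bar> \<le> M \<and> \<bar>q j\<bar> \<le> M \<and> \<bar>p j - q j\<bar> \<le> d) \<longrightarrow> \<bar>F p - F q\<bar> \<le> K * d)"

text \<open>Near \<open>s\<close> the finitely many coordinates stay within 1 of their values at
  \<open>s\<close>. One cube with one Lipschitz constant therefore suffices, and the sum of the
  coordinate changes controls the change of \<open>F\<close>.\<close>

lemma continuous_on_locally_lipschitz_in:
  assumes "finite J" "locally_lipschitz_in J F"
    and cont: "\<And>j. j \<in> J \<Longrightarrow> continuous_on S (\<lambda>s. x j s)"
  shows "continuous_on S (\<lambda>s. F (\<lambda>j. x j s))"
  unfolding continuous_on_def
proof
  fix s assume "s \<in> S"
  define M where "M = (\<Sum>j\<in>J. \<bar>x j s\<bar>) + 1"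
  obtain K where K: "\<And>p q d. 0 \<le> d \<Longrightarrow> (\<And>j. j \<in> J \<Longrightarrow> \<bar>p j\<bar> \<le> M \<and> \<bar>q j\<bar> \<le> M \<and> \<bar>p j - q j\<bar> \<le> d)
      \<Longrightarrow> \<bar>F p - F q\<bar> \<le> K * d"
    using assms(2) unfolding locally_lipschitz_in_def by metis
  have lim: "((\<lambda>s'. x j s') \<longlongrightarrow> x j s) (at s within S)" if "j \<in> J" for j
    using cont[OF that] \<open>s \<in> S\<close> by (auto simp: continuous_on_def)
  have "\<forall>\<^sub>F s' in at s within S. \<forall>j\<in>J. dist (x j s') (x j s) < 1"
    using lim assms(1) by (intro eventually_ball_finite) (auto intro: tendstoD)
  then have "\<forall>\<^sub>F s' in at s within S.
      norm (F (\<lambda>j. x j s') - F (\<lambda>j. x j s)) \<le> K * (\<Sum>j\<in>J. \<bar>x j s' - x j s\<bar>)"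
  proof eventually_elim
    case (elim s')
    have "\<bar>F (\<lambda>j. x j s') - F (\<lambda>j. x j s)\<bar> \<le> K * (\<Sum>j\<in>J. \<bar>x j s' - x j s\<bar>)"
    proof (rule K)
      fix j assume j: "j \<in> J"
      have "\<bar>x j s\<bar> \<le> (\<Sum>j\<in>J. \<bar>x j s\<bar>)" "\<bar>x j s' - x j s\<bar> \<le> (\<Sum>j\<in>J. \<bar>x j s' - x j s\<bar>)"
        by (rule member_le_sum; use j assms(1) in simp)+
      then show "\<bar>x j s'\<bar> \<le> M \<and> \<bar>x j s\<bar> \<le> M \<and> \<bar>x j s' - x j s\<bar> \<le> (\<Sum>j\<in>J. \<bar>x j s' - x j s\<bar>)"
        using elim j by (fastforce simp: M_def dist_real_def)
    qed (simp add: sum_nonneg)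
    then show ?case by simp
  qed
  moreover have "((\<lambda>s'. K * (\<Sum>j\<in>J. \<bar>x j s' - x j s\<bar>)) \<longlongrightarrow> K * (\<Sum>j\<in>J. \<bar>x j s - x j s\<bar>)) (at s within S)"
    by (intro tendsto_intros lim)
  then have "((\<lambda>s'. K * (\<Sum>j\<in>J. \<bar>x j s' - x j s\<bar>)) \<longlongrightarrow> 0) (at s within S)" by simp
  ultimately have "((\<lambda>s'. F (\<lambda>j. x j s') - F (\<lambda>j. x j s)) \<longlongrightarrow> 0) (at s within S)"
    by (rule Lim_null_comparison)
  then show "((\<lambda>s'. F (\<lambda>j. x j s')) \<longlongrightarrow> F (\<lambda>j. x j s)) (at s within S)"
    by (rule LIM_zero_cancel)
qed

text \<open>Integrating the weight \<open>exp (2 * K * t)\<close> gains a factor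
  \<open>1 / (2 * K)\<close>. Against the Lipschitz constant \<open>K\<close> this leaves the
  contraction factor 1/2.\<close>

lemma abs_integral_le_exp:
  fixes F :: "real \<Rightarrow> real"
  assumes "K > 0" "0 \<le> s" "continuous_on {0..s} F"
    and "\<And>t. 0 \<le> t \<Longrightarrow> t \<le> s \<Longrightarrow> \<bar>F t\<bar> \<le> c * exp (2 * K * t)"
  shows "\<bar>integral {0..s} F\<bar> \<le> c / (2 * K) * (exp (2 * K * s) - 1)"
proof -
  have I: "((\<lambda>t. c * exp (2 * K * t)) has_integral
      (c / (2 * K) * exp (2 * K * s) - c / (2 * K) * exp (2 * K * 0))) {0..s}"
    using assms(1,2)
    by (intro fundamental_theorem_of_calculus)
      (auto intro!: derivative_eq_intros simp flip: has_real_derivative_iff_has_vector_derivative)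
  have "norm (integral {0..s} F) \<le> integral {0..s} (\<lambda>t. c * exp (2 * K * t))"
    using assms(3,4) I
    by (intro Henstock_Kurzweil_Integration.integral_norm_bound_integral integrable_continuous_real)
      (auto intro!: continuous_intros)
  also have "\<dots> = c / (2 * K) * (exp (2 * K * s) - 1)"
    using integral_unique[OF I] by (simp add: algebra_simps)
  finally show ?thesis by simp
qed

text \<open>The Picard operator is a contraction of bounded functions after division of the unknown
  by \<open>exp (2 * K * s)\<close>; this yields a solution on the whole half line at once. A family of
  functions is regarded as one function of index and time; \<open>discrete\<close> makes the index type a
  metric space, as the completeness of the bounded continuous functions requires.\<close>

lemma picard_atLeast:
  fixes f :: "'i \<Rightarrow> ('i \<Rightarrow> real) \<Rightarrow> real" and g :: "'i \<Rightarrow> real"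
  assumes "finite J" and K: "K > 0"
    and lip: "\<And>i x y d. 0 \<le> d \<Longrightarrow> (\<And>j. j \<in> J \<Longrightarrow> \<bar>x j - y j\<bar> \<le> d) \<Longrightarrow> \<bar>f i x - f i y\<bar> \<le> K * d"
    and A: "\<And>i. \<bar>f i (\<lambda>_. 0)\<bar> \<le> A" "\<And>i. \<bar>g i\<bar> \<le> A"
  shows "\<exists>w. \<forall>i. w i 0 = g i \<and>
    (\<forall>s\<ge>0. (w i has_real_derivative f i (\<lambda>j. w j s)) (at s within {0..}))"
proof -
  define E where "E s = exp (2 * K * s)" for s
  have E: "E s > 0" for s by (simp add: E_def)
  have E1: "E s \<ge> 1" if "s \<ge> 0" for s using that K by (simp add: E_def)
  have contE: "continuous_on S E" for S
    unfolding E_def by (intro continuous_intros)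
  define F where "F u i t = f i (\<lambda>j. E t * apply_bcontfun u (discrete j, t))" for u i t
  define w where "w u i s = g i + integral {0..s} (F u i)" for u i s
  \<comment> \<open>\<open>u\<close> stands for the unknown divided by the weight, and
    \<open>w u\<close> is the unweighted Picard iterate. Freezing time at 0 for negative
    \<open>s\<close> extends the iterate continuously to all reals, since bounded continuous
    functions live on a whole type.\<close>
  define \<Phi> where "\<Phi> u = (\<lambda>(i, s). w u (of_discrete i) (max 0 s) / E (max 0 s))" for u
  have ll: "locally_lipschitz_in J (f i)" for i
    unfolding locally_lipschitz_in_def using lip K by (metis less_imp_le)
  have contu: "continuous_on S (\<lambda>t. apply_bcontfun u (discrete j, t))" for S u j
    using continuous_on_compose2[OF continuous_on_apply_bcontfun[of UNIV u], of S "Pair (discrete j)"]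
    by (simp add: continuous_on_Pair)
  have contF: "continuous_on S (F u i)" for S u i
    unfolding F_def
    by (rule continuous_on_locally_lipschitz_in[OF \<open>finite J\<close> ll, of S "\<lambda>j t. E t * apply_bcontfun u (discrete j, t)"])
      (rule continuous_on_mult[OF contE contu])
  have deriv: "(w u i has_real_derivative F u i s) (at s within {0..})" if "s \<ge> 0" for u i s
    unfolding w_def using integral_has_real_derivative_atLeast[OF contF that, of u i]
    by (auto intro!: derivative_eq_intros)
  then have contw: "continuous_on {0..} (w u i)" for u i
    by (intro DERIV_continuous_on) auto
  have bound: "\<bar>f i x\<bar> \<le> A + K * d" if "0 \<le> d" "\<And>j. j \<in> J \<Longrightarrow> \<bar>x j\<bar> \<le> d" for i x d
    using lip[OF that(1), of x "\<lambda>_. 0" i] that(2) A(1)[of i] by fastforce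
  have \<Phi>: "\<Phi> u \<in> bcontfun" for u
  proof -
    have "continuous_on UNIV (\<Phi> u)"
    proof (rule continuous_on_discrete_times)
      fix i
      show "continuous_on UNIV (\<lambda>s. \<Phi> u (i, s))"
        unfolding \<Phi>_def using E
        by (auto intro!: continuous_intros continuous_on_compose2[OF contw] continuous_on_compose2[OF contE[of UNIV]] simp: less_imp_neq[symmetric])
    qed
    moreover
    obtain D where D: "\<And>x. \<bar>apply_bcontfun u x\<bar> \<le> D" "D \<ge> 0"
      using bounded_apply_bcontfun[of u] unfolding bounded_pos by force
    have "A \<ge> 0" using A(2) by (meson abs_ge_zero order_trans)
    have "\<bar>\<Phi> u (discrete i, s)\<bar> \<le> A + (A + K * D) / (2 * K)" for i s
    proof -
      define r where "r = max 0 s"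
      have "r \<ge> 0" by (simp add: r_def)
      have "\<bar>F u i t\<bar> \<le> (A + K * D) * exp (2 * K * t)" if "0 \<le> t" for t
      proof -
        have "\<bar>F u i t\<bar> \<le> A + K * (E t * D)"
          unfolding F_def using D E[of t]
          by (intro bound) (auto simp: abs_mult intro!: mult_mono)
        also have "\<dots> \<le> A * E t + K * (E t * D)"
          using mult_left_mono[OF E1[OF that] \<open>A \<ge> 0\<close>] by simp
        finally show ?thesis by (simp add: E_def algebra_simps)
      qed
      then have "\<bar>integral {0..r} (F u i)\<bar> \<le> (A + K * D) / (2 * K) * (exp (2 * K * r) - 1)"
        using \<open>r \<ge> 0\<close> K by (intro abs_integral_le_exp contF) auto
      also have "\<dots> \<le> (A + K * D) / (2 * K) * E r"
        using \<open>A \<ge> 0\<close> D K by (intro mult_left_mono) (auto simp: E_def)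
      finally have "\<bar>w u i r\<bar> \<le> A * E r + (A + K * D) / (2 * K) * E r"
        using A(2)[of i] mult_left_mono[OF E1[OF \<open>r \<ge> 0\<close>] \<open>A \<ge> 0\<close>]
        unfolding w_def by linarith
      then show ?thesis
        using E[of r] by (simp add: \<Phi>_def discrete_inverse field_simps flip: r_def)
    qed
    then have "\<bar>\<Phi> u x\<bar> \<le> A + (A + K * D) / (2 * K)" for x
      by (metis of_discrete_inverse surj_pair)
    then have "bounded (range (\<Phi> u))" by (auto simp: bounded_iff)
    ultimately show ?thesis by (simp add: bcontfun_def)
  qed
  then have app: "apply_bcontfun (Bcontfun (\<Phi> u)) = \<Phi> u" for u
    by (simp add: Bcontfun_inverse)
  have "dist (Bcontfun (\<Phi> u)) (Bcontfun (\<Phi> v)) \<le> (1/2) * dist u v" for u v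
  proof (rule dist_bound, unfold app)
    fix x :: "'i discrete \<times> real"
    obtain i s where x: "x = (discrete i, s)"
      by (metis of_discrete_inverse surj_pair)
    define r where "r = max 0 s"
    have "r \<ge> 0" by (simp add: r_def)
    have "\<bar>F u i t - F v i t\<bar> \<le> (K * dist u v) * exp (2 * K * t)" for t
    proof -
      have "\<bar>E t * apply_bcontfun u (discrete j, t) - E t * apply_bcontfun v (discrete j, t)\<bar> \<le> E t * dist u v" for j
        using dist_bounded[of u "(discrete j, t)" v] E[of t]
        by (auto simp: abs_mult dist_real_def simp flip: right_diff_distrib intro!: mult_mono)
      then have "\<bar>F u i t - F v i t\<bar> \<le> K * (E t * dist u v)"
        unfolding F_def using E[of t] by (intro lip) auto
      then show ?thesis by (simp add: E_def algebra_simps)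
    qed
    then have "\<bar>integral {0..r} (\<lambda>t. F u i t - F v i t)\<bar>
        \<le> (K * dist u v) / (2 * K) * (exp (2 * K * r) - 1)"
      using \<open>r \<ge> 0\<close> K by (intro abs_integral_le_exp continuous_intros contF) auto
    also have "\<dots> \<le> dist u v / 2 * E r"
      using K by (simp add: E_def field_simps)
    also have "integral {0..r} (\<lambda>t. F u i t - F v i t) = w u i r - w v i r"
      by (simp add: w_def Henstock_Kurzweil_Integration.integral_diff integrable_continuous_real contF)
    finally have "\<bar>w u i r - w v i r\<bar> / E r \<le> dist u v / 2"
      using E[of r] by (simp add: field_simps)
    then show "dist (\<Phi> u x) (\<Phi> v x) \<le> (1/2) * dist u v"
      using E[of r]
      by (simp add: x \<Phi>_def discrete_inverse dist_real_def flip: r_def diff_divide_distrib)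
  qed
  then obtain u where u: "Bcontfun (\<Phi> u) = u"
    using banach_fix_type[of "1/2" "\<lambda>u. Bcontfun (\<Phi> u)"] by auto
  \<comment> \<open>At the fixed point \<open>w u\<close> is the unknown itself, so its derivative,
    computed from \<open>u\<close>, is the right-hand side evaluated at \<open>w u\<close>.\<close>
  have wu: "w u i s = E s * apply_bcontfun u (discrete i, s)" if "s \<ge> 0" for i s
  proof -
    have "apply_bcontfun u (discrete i, s) = \<Phi> u (discrete i, s)" using app[of u] u by simp
    then show ?thesis using that E[of s] by (simp add: \<Phi>_def discrete_inverse)
  qed
  have "w u i 0 = g i" for i by (simp add: w_def)
  moreover have "(w u i has_real_derivative f i (\<lambda>j. w u j s)) (at s within {0..})" if "s \<ge> 0" for i s
    using deriv[OF that, of u i] wu[OF that] by (simp add: F_def)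
  ultimately show ?thesis by blast
qed

text \<open>Reversing time by \<open>T - t\<close> only flips the sign of the right-hand side, which
  preserves the Lipschitz constant and the bounds.\<close>

lemma picard_atMost:
  fixes f :: "'i \<Rightarrow> ('i \<Rightarrow> real) \<Rightarrow> real" and g :: "'i \<Rightarrow> real"
  assumes "finite J" and K: "K > 0"
    and lip: "\<And>i x y d. 0 \<le> d \<Longrightarrow> (\<And>j. j \<in> J \<Longrightarrow> \<bar>x j - y j\<bar> \<le> d) \<Longrightarrow> \<bar>f i x - f i y\<bar> \<le> K * d"
    and A: "\<And>i. \<bar>f i (\<lambda>_. 0)\<bar> \<le> A" "\<And>i. \<bar>g i\<bar> \<le> A"
  shows "\<exists>w. \<forall>i. w i T = g i \<and>
    (\<forall>t\<le>T. (w i has_real_derivative f i (\<lambda>j. w j t)) (at t within {..T}))"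
proof -
  have "\<exists>w. \<forall>i. w i 0 = g i \<and>
      (\<forall>s\<ge>0. (w i has_real_derivative - f i (\<lambda>j. w j s)) (at s within {0..}))"
  proof (rule picard_atLeast[OF \<open>finite J\<close> K])
    fix i :: 'i and x y :: "'i \<Rightarrow> real" and d :: real
    assume "0 \<le> d" "\<And>j. j \<in> J \<Longrightarrow> \<bar>x j - y j\<bar> \<le> d"
    from lip[of d x y i, OF this] show "\<bar>- f i x - - f i y\<bar> \<le> K * d" by linarith
  qed (use A in auto)
  then obtain w where w0: "\<And>i. w i 0 = g i"
    and w: "\<And>i s. s \<ge> 0 \<Longrightarrow> (w i has_real_derivative - f i (\<lambda>j. w j s)) (at s within {0..})"
    by blast
  have "((\<lambda>t. w i (T - t)) has_real_derivative f i (\<lambda>j. w j (T - t))) (at t within {..T})"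
    if "t \<le> T" for i t
  proof -
    have "(w i has_real_derivative - f i (\<lambda>j. w j (T - t))) (at (T - t) within (\<lambda>t. T - t) ` {..T})"
      using that by (intro has_field_derivative_subset[OF w]) auto
    moreover have "((\<lambda>t. T - t) has_real_derivative - 1) (at t within {..T})"
      by (auto intro!: derivative_eq_intros)
    ultimately show ?thesis
      using DERIV_image_chain[of "w i" _ "\<lambda>t. T - t"] by (fastforce simp: o_def)
  qed
  then show ?thesis using w0 by (intro exI[of _ "\<lambda>i t. w i (T - t)"]) auto
qed

subsection \<open>Monotone systems\<close>

text \<open>The penalty \<open>(B + e) * (T - t)\<close> is the same for all indices, so where the
  penalised functions are maximal over all indices and times, the index also maximises
  \<open>u\<close>. If that maximum exceeded \<open>G\<close>, it would occur before
  \<open>T\<close> with \<open>u\<close> nonnegative; \<open>argmax\<close> then makes the penalised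
  derivative at least \<open>e\<close>, so the function still grows to the right. Finally
  \<open>e\<close> tends to 0.\<close>

lemma terminal_max_principle:
  fixes u D :: "'i \<Rightarrow> real \<Rightarrow> real"
  assumes "finite I" "0 \<le> B" "0 \<le> G"
    and deriv: "\<And>i t. i \<in> I \<Longrightarrow> a \<le> t \<Longrightarrow> t \<le> T \<Longrightarrow> (u i has_real_derivative D i t) (at t within {..T})"
    and terminal: "\<And>i. i \<in> I \<Longrightarrow> u i T \<le> G"
    and argmax: "\<And>i t. i \<in> I \<Longrightarrow> a \<le> t \<Longrightarrow> t < T \<Longrightarrow> 0 \<le> u i t \<Longrightarrow>
      (\<And>j. j \<in> I \<Longrightarrow> u j t \<le> u i t) \<Longrightarrow> - B \<le> D i t"
    and "i \<in> I" "a \<le> t" "t \<le> T"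
  shows "u i t \<le> G + B * (T - t)"
proof -
  have main: "u i t \<le> G + (B + e) * (T - t)" if "e > 0" for e
  proof -
    define \<phi> where "\<phi> i t = u i t - (B + e) * (T - t)" for i t
    have der: "(\<phi> i has_real_derivative (D i t + (B + e))) (at t within {..T})"
      if "i \<in> I" "a \<le> t" "t \<le> T" for i t
      unfolding \<phi>_def using deriv[OF that] by (auto intro!: derivative_eq_intros)
    have "continuous_on {a..T} (\<phi> i)" if "i \<in> I" for i
    proof (rule DERIV_continuous_on)
      show "(\<phi> i has_real_derivative (D i t + (B + e))) (at t within {a..T})" if "t \<in> {a..T}" for t
        using that \<open>i \<in> I\<close> by (intro has_field_derivative_subset[OF der]) auto
    qed
    then have "\<exists>s\<in>{a..T}. \<forall>t\<in>{a..T}. \<phi> i t \<le> \<phi> i s" if "i \<in> I" for i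
      using that \<open>a \<le> t\<close> \<open>t \<le> T\<close> by (intro continuous_attains_sup) auto
    then obtain s where s: "\<And>i. i \<in> I \<Longrightarrow> s i \<in> {a..T}"
      "\<And>i t. i \<in> I \<Longrightarrow> t \<in> {a..T} \<Longrightarrow> \<phi> i t \<le> \<phi> i (s i)"
      by metis
    have "Max ((\<lambda>i. \<phi> i (s i)) ` I) \<in> (\<lambda>i. \<phi> i (s i)) ` I"
      using \<open>finite I\<close> \<open>i \<in> I\<close> by (intro Max_in) auto
    then obtain k where k: "k \<in> I" "Max ((\<lambda>i. \<phi> i (s i)) ` I) = \<phi> k (s k)" by auto
    have max: "\<phi> j t \<le> \<phi> k (s k)" if "j \<in> I" "t \<in> {a..T}" for j t
      using s(2)[OF that] Max_ge[of "(\<lambda>i. \<phi> i (s i)) ` I" "\<phi> j (s j)"] \<open>finite I\<close> that(1) k(2)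
      by fastforce
    have "\<phi> k (s k) \<le> G"
    proof (rule ccontr)
      assume neg: "\<not> \<phi> k (s k) \<le> G"
      have sk: "a \<le> s k" "s k \<le> T" using s(1)[OF k(1)] by auto
      have "s k \<noteq> T" using neg terminal[OF k(1)] by (auto simp: \<phi>_def)
      then have "s k < T" using sk by simp
      have "0 \<le> (B + e) * (T - s k)" using \<open>e > 0\<close> \<open>0 \<le> B\<close> sk by simp
      then have "0 \<le> u k (s k)" using neg \<open>0 \<le> G\<close> by (simp add: \<phi>_def)
      moreover have "u j (s k) \<le> u k (s k)" if "j \<in> I" for j
        using max[OF that, of "s k"] sk by (simp add: \<phi>_def)
      ultimately have "0 < D k (s k) + (B + e)"
        using argmax[OF k(1) sk(1) \<open>s k < T\<close>] \<open>e > 0\<close> by simp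
      from has_real_derivative_pos_inc_right[OF der[OF k(1) sk] this]
      obtain d where d: "d > 0" "\<And>h. 0 < h \<Longrightarrow> s k + h \<le> T \<Longrightarrow> h < d \<Longrightarrow> \<phi> k (s k) < \<phi> k (s k + h)"
        by auto
      define h where "h = min (d / 2) (T - s k)"
      have "0 < h" "s k + h \<le> T" "h < d" using d(1) \<open>s k < T\<close> by (auto simp: h_def)
      with d(2)[OF this] max[OF k(1), of "s k + h"] sk show False by simp
    qed
    with max[OF \<open>i \<in> I\<close>, of t] assms(8,9) show ?thesis by (simp add: \<phi>_def)
  qed
  show ?thesis
  proof (rule field_le_epsilon)
    fix e :: real assume "e > 0"
    \<comment> \<open>The slack times \<open>T - t\<close> stays below \<open>e\<close>, and the
      added 1 avoids division by zero at \<open>t = T\<close>.\<close>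
    then have "u i t \<le> G + (B + e / (1 + (T - t))) * (T - t)"
      using \<open>t \<le> T\<close> by (intro main) auto
    also have "\<dots> \<le> G + B * (T - t) + e"
      using \<open>e > 0\<close> \<open>t \<le> T\<close> by (simp add: field_simps)
    finally show "u i t \<le> G + B * (T - t) + e" .
  qed
qed

section \<open>Truncated differences and abstract monotone systems\<close>

definition clamp_abs :: "real \<Rightarrow> real \<Rightarrow> real" where
  "clamp_abs M x = max (- M) (min M x)"

lemma abs_clamp_abs: "0 \<le> M \<Longrightarrow> \<bar>clamp_abs M x\<bar> \<le> M"
  by (simp add: clamp_abs_def abs_le_iff)

lemma clamp_abs_eq: "\<bar>x\<bar> \<le> M \<Longrightarrow> clamp_abs M x = x"
  by (simp add: clamp_abs_def abs_le_iff)

lemma abs_clamp_abs_diff_le: "\<bar>clamp_abs M x - clamp_abs M y\<bar> \<le> \<bar>x - y\<bar>"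
  by (simp add: clamp_abs_def max_def min_def)

text \<open>\<open>h\<close> abstracts the Hamiltonians. Applied in both directions,
  \<open>mono\<close> also says that \<open>h i\<close> reads only the coordinates in
  \<open>nb i\<close>; equalities between values of \<open>h\<close> rest on this.\<close>

locale monotone_system =
  fixes I :: "'i set" and nb :: "'i \<Rightarrow> 'i set"
    and h :: "'i \<Rightarrow> ('i \<Rightarrow> real) \<Rightarrow> real" and r :: real
  assumes finite_I: "finite I"
    and nb: "i \<in> I \<Longrightarrow> nb i \<subseteq> I"
    and r_nonneg: "0 \<le> r"
    and mono: "i \<in> I \<Longrightarrow> (\<And>j. j \<in> nb i \<Longrightarrow> p j \<le> q j) \<Longrightarrow> h i p \<le> h i q"
    and locally_lipschitz: "i \<in> I \<Longrightarrow> locally_lipschitz_in (nb i) (h i)"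
begin

text \<open>The equation is required on \<open>[a, T]\<close>, but the derivative is always taken
  within \<open>{..T}\<close>, hence two-sided at \<open>a\<close> if \<open>a < T\<close>.
  Requiring this for every \<open>a\<close> gives a solution on the whole half-line.\<close>

definition solution :: "real \<Rightarrow> real \<Rightarrow> ('i \<Rightarrow> real \<Rightarrow> real) \<Rightarrow> bool" where
  "solution a T V \<longleftrightarrow> (\<forall>i\<in>I. \<forall>t. a \<le> t \<and> t \<le> T \<longrightarrow>
     (V i has_real_derivative r * V i t - h i (\<lambda>j. V j t - V i t)) (at t within {..T}))"

lemma solutionD:
  "solution a T V \<Longrightarrow> i \<in> I \<Longrightarrow> a \<le> t \<Longrightarrow> t \<le> T \<Longrightarrow>
    (V i has_real_derivative r * V i t - h i (\<lambda>j. V j t - V i t)) (at t within {..T})"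
  by (auto simp: solution_def)

text \<open>The maximum principle is applied to \<open>u - v\<close> with both constants 0. At a
  node \<open>i\<close> with maximal difference, \<open>u j - u i\<close> is at most
  \<open>v j - v i\<close>, so \<open>mono\<close> orders the Hamiltonian terms; where that
  difference is nonnegative, so is its product with \<open>r\<close>. Separate starting times serve
  the later gluing.\<close>

lemma comparison:
  assumes u: "solution a T u" and v: "solution b T v"
    and terminal: "\<And>i. i \<in> I \<Longrightarrow> u i T \<le> v i T"
    and "i \<in> I" "a \<le> t" "b \<le> t" "t \<le> T"
  shows "u i t \<le> v i t"
proof -
  have "u i t - v i t \<le> 0 + 0 * (T - t)"
  proof (rule terminal_max_principle[where u = "\<lambda>i t. u i t - v i t" and a = t and I = I])
    fix i s assume "i \<in> I" "t \<le> s" "s \<le> T"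
    then show "((\<lambda>t. u i t - v i t) has_real_derivative
        (r * u i s - h i (\<lambda>j. u j s - u i s)) - (r * v i s - h i (\<lambda>j. v j s - v i s))) (at s within {..T})"
      using assms by (intro DERIV_diff solutionD[OF u] solutionD[OF v]) auto
  next
    fix i s assume i: "i \<in> I" "0 \<le> u i s - v i s"
      and max: "\<And>j. j \<in> I \<Longrightarrow> u j s - v j s \<le> u i s - v i s"
    have "h i (\<lambda>j. u j s - u i s) \<le> h i (\<lambda>j. v j s - v i s)"
      using nb[OF i(1)] by (intro mono[OF i(1)]) (smt (verit) max subsetD)
    moreover have "0 \<le> r * (u i s - v i s)" using i(2) r_nonneg by simp
    ultimately show "- 0 \<le> (r * u i s - h i (\<lambda>j. u j s - u i s)) - (r * v i s - h i (\<lambda>j. v j s - v i s))"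
      by (simp add: algebra_simps)
  qed (use assms finite_I in auto)
  then show ?thesis by simp
qed

lemma solution_unique:
  assumes "solution a T u" "solution b T v" "\<And>i. i \<in> I \<Longrightarrow> u i T = v i T"
    and "i \<in> I" "a \<le> t" "b \<le> t" "t \<le> T"
  shows "u i t = v i t"
  using comparison[of a T u b v i t] comparison[of b T v a u i t] assms by (auto intro: antisym)

text \<open>Clamping keeps signs. Where \<open>W i\<close> is largest and nonnegative, the clamped
  differences are nonpositive, so \<open>h i\<close> is at most its value at 0 and the derivative is
  at least \<open>- B\<close>. The lower bound is the same argument for \<open>- W\<close>.\<close>

lemma clamped_solution_bounded:
  assumes "0 \<le> M" "0 \<le> B" "0 \<le> G"
    and W: "\<And>i t. i \<in> I \<Longrightarrow> t \<le> T \<Longrightarrow>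
      (W i has_real_derivative r * W i t - h i (\<lambda>j. clamp_abs M (W j t - W i t))) (at t within {..T})"
    and B: "\<And>i. i \<in> I \<Longrightarrow> \<bar>h i (\<lambda>_. 0)\<bar> \<le> B"
    and G: "\<And>i. i \<in> I \<Longrightarrow> \<bar>W i T\<bar> \<le> G"
    and "i \<in> I" "t \<le> T"
  shows "\<bar>W i t\<bar> \<le> G + B * (T - t)"
proof -
  have "W i t \<le> G + B * (T - t)"
  proof (rule terminal_max_principle[where u = W and a = t and I = I])
    fix i s assume i: "i \<in> I" "0 \<le> W i s" and max: "\<And>j. j \<in> I \<Longrightarrow> W j s \<le> W i s"
    have "h i (\<lambda>j. clamp_abs M (W j s - W i s)) \<le> h i (\<lambda>_. 0)"
      using nb[OF i(1)] max \<open>0 \<le> M\<close> by (intro mono[OF i(1)]) (fastforce simp: clamp_abs_def)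
    moreover have "0 \<le> r * W i s" using i(2) r_nonneg by simp
    ultimately show "- B \<le> r * W i s - h i (\<lambda>j. clamp_abs M (W j s - W i s))"
      using B[OF i(1)] by linarith
  qed (use assms finite_I in \<open>auto simp: abs_le_iff\<close>)
  moreover have "- W i t \<le> G + B * (T - t)"
  proof (rule terminal_max_principle[where u = "\<lambda>i t. - W i t" and a = t and I = I])
    fix i s assume "i \<in> I" "s \<le> T"
    then show "((\<lambda>t. - W i t) has_real_derivative
        - (r * W i s - h i (\<lambda>j. clamp_abs M (W j s - W i s)))) (at s within {..T})"
      by (intro DERIV_minus W)
  next
    fix i s assume i: "i \<in> I" "0 \<le> - W i s" and max: "\<And>j. j \<in> I \<Longrightarrow> - W j s \<le> - W i s"
    have "h i (\<lambda>_. 0) \<le> h i (\<lambda>j. clamp_abs M (W j s - W i s))"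
      using nb[OF i(1)] max \<open>0 \<le> M\<close> by (intro mono[OF i(1)]) (fastforce simp: clamp_abs_def)
    moreover have "0 \<le> r * (- W i s)" using i(2) r_nonneg by (intro mult_nonneg_nonneg)
    ultimately show "- B \<le> - (r * W i s - h i (\<lambda>j. clamp_abs M (W j s - W i s)))"
      using B[OF i(1)] by linarith
  qed (use assms finite_I in \<open>auto simp: abs_le_iff\<close>)
  ultimately show ?thesis by linarith
qed

text \<open>The a priori bound does not depend on the clamping level \<open>M\<close>, so for \<open>M\<close> large the
  clamped solution solves the original system on \<open>[a, T]\<close>.\<close>

lemma solution_exists_Icc:
  assumes "a \<le> T"
  shows "\<exists>V. solution a T V \<and> (\<forall>i\<in>I. V i T = g i)"
proof -
  define B where "B = (\<Sum>i\<in>I. \<bar>h i (\<lambda>_. 0)\<bar>)"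
  define G where "G = (\<Sum>i\<in>I. \<bar>g i\<bar>)"
  \<comment> \<open>Twice the a priori bound at time \<open>a\<close>, because what is clamped is a
    difference of two components.\<close>
  define M where "M = 2 * (G + B * (T - a))"
  have B: "\<bar>h i (\<lambda>_. 0)\<bar> \<le> B" if "i \<in> I" for i
    unfolding B_def using that finite_I by (intro member_le_sum) auto
  have G: "\<bar>g i\<bar> \<le> G" if "i \<in> I" for i
    unfolding G_def using that finite_I by (intro member_le_sum) auto
  have nonneg: "0 \<le> B" "0 \<le> G" by (auto simp: B_def G_def sum_nonneg)
  then have "0 \<le> M" using assms by (simp add: M_def)
  have "\<forall>i\<in>I. \<exists>K\<ge>0. \<forall>p q d. 0 \<le> d \<longrightarrow>
      (\<forall>j\<in>nb i. \<bar>p j\<bar> \<le> M \<and> \<bar>q j\<bar> \<le> M \<and> \<bar>p j - q j\<bar> \<le> d) \<longrightarrow> \<bar>h i p - h i q\<bar> \<le> K * d"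
    using locally_lipschitz unfolding locally_lipschitz_in_def by blast
  then obtain k where k: "\<And>i. i \<in> I \<Longrightarrow> 0 \<le> k i"
    "\<And>i p q d. i \<in> I \<Longrightarrow> 0 \<le> d \<Longrightarrow> (\<And>j. j \<in> nb i \<Longrightarrow> \<bar>p j\<bar> \<le> M \<and> \<bar>q j\<bar> \<le> M \<and> \<bar>p j - q j\<bar> \<le> d)
      \<Longrightarrow> \<bar>h i p - h i q\<bar> \<le> k i * d"
    by metis
  \<comment> \<open>A change of \<open>x\<close> by at most \<open>d\<close> moves each difference
    by at most \<open>2 * d\<close>, hence the factor 2. The summand 1 makes \<open>K\<close>
    positive.\<close>
  define K where "K = r + 2 * (\<Sum>i\<in>I. k i) + 1"
  have K: "r + 2 * k i \<le> K" if "i \<in> I" for i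
    using member_le_sum[of i I k] k(1) that finite_I by (auto simp: K_def)
  have "0 < K" using k(1) r_nonneg by (auto simp: K_def add_nonneg_pos sum_nonneg)
  \<comment> \<open>The Picard lemma asks for bounds over the whole index type, so right-hand side
    and terminal data are set to 0 outside \<open>I\<close>.\<close>
  define f where
    "f i x = (if i \<in> I then r * x i - h i (\<lambda>j. clamp_abs M (x j - x i)) else 0)" for i x
  have "\<exists>W. \<forall>i. W i T = (if i \<in> I then g i else 0) \<and>
      (\<forall>t\<le>T. (W i has_real_derivative f i (\<lambda>j. W j t)) (at t within {..T}))"
  proof (rule picard_atMost[OF finite_I \<open>0 < K\<close>])
    fix d and x y :: "'i \<Rightarrow> real" and i
    assume d: "0 \<le> d" "\<And>j. j \<in> I \<Longrightarrow> \<bar>x j - y j\<bar> \<le> d"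
    show "\<bar>f i x - f i y\<bar> \<le> K * d"
    proof (cases "i \<in> I")
      case True
      have "\<bar>h i (\<lambda>j. clamp_abs M (x j - x i)) - h i (\<lambda>j. clamp_abs M (y j - y i))\<bar> \<le> k i * (2 * d)"
      proof (rule k(2)[OF True])
        fix j assume "j \<in> nb i"
        then have "j \<in> I" using nb[OF True] by blast
        then show "\<bar>clamp_abs M (x j - x i)\<bar> \<le> M \<and> \<bar>clamp_abs M (y j - y i)\<bar> \<le> M \<and>
            \<bar>clamp_abs M (x j - x i) - clamp_abs M (y j - y i)\<bar> \<le> 2 * d"
          using d(2)[of j] d(2)[OF True] \<open>0 \<le> M\<close>
            abs_clamp_abs_diff_le[of M "x j - x i" "y j - y i"]
          by (simp add: abs_clamp_abs)
      qed (use d in simp)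
      moreover have "\<bar>r * x i - r * y i\<bar> \<le> r * d"
        using d(2)[OF True] r_nonneg by (simp add: abs_mult mult_left_mono flip: right_diff_distrib)
      moreover have "(r + 2 * k i) * d \<le> K * d"
        using K[OF True] d(1) by (rule mult_right_mono)
      ultimately show ?thesis using True by (simp add: f_def algebra_simps)
    qed (use d \<open>0 < K\<close> in \<open>simp add: f_def\<close>)
  next
    fix i
    show "\<bar>f i (\<lambda>_. 0)\<bar> \<le> B + G" "\<bar>if i \<in> I then g i else 0\<bar> \<le> B + G"
      using B[of i] G[of i] nonneg \<open>0 \<le> M\<close> by (auto simp: f_def clamp_abs_def)
  qed
  then obtain W where f: "\<And>i. W i T = (if i \<in> I then g i else 0)"
    "\<And>i t. t \<le> T \<Longrightarrow> (W i has_real_derivative f i (\<lambda>j. W j t)) (at t within {..T})"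
    by blast
  have W: "W i T = g i"
    "t \<le> T \<Longrightarrow>
      (W i has_real_derivative r * W i t - h i (\<lambda>j. clamp_abs M (W j t - W i t))) (at t within {..T})"
    if "i \<in> I" for i t
    using f(1)[of i] f(2)[of t i] that by (simp_all add: f_def)
  have bound: "\<bar>W i t\<bar> \<le> M / 2" if "i \<in> I" "a \<le> t" "t \<le> T" for i t
  proof -
    have "\<bar>W i t\<bar> \<le> G + B * (T - t)"
      by (rule clamped_solution_bounded[OF \<open>0 \<le> M\<close> nonneg W(2) B])
        (use W(1) G that in auto)
    also have "\<dots> \<le> M / 2" using that nonneg by (simp add: M_def mult_left_mono)
    finally show ?thesis .
  qed
  have "solution a T W"
    unfolding solution_def
  proof (intro ballI allI impI)
    fix i t assume it: "i \<in> I" "a \<le> t \<and> t \<le> T"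
    have "clamp_abs M (W j t - W i t) = W j t - W i t" if "j \<in> nb i" for j
    proof -
      have "\<bar>W j t\<bar> \<le> M / 2" "\<bar>W i t\<bar> \<le> M / 2" using bound that nb it by blast+
      then show ?thesis by (intro clamp_abs_eq) linarith
    qed
    then have "h i (\<lambda>j. clamp_abs M (W j t - W i t)) = h i (\<lambda>j. W j t - W i t)"
      using it(1) by (intro antisym mono) auto
    then show "(W i has_real_derivative r * W i t - h i (\<lambda>j. W j t - W i t)) (at t within {..T})"
      using W(2)[of i t] it by simp
  qed
  with W(1) show ?thesis by blast
qed

text \<open>By uniqueness the solutions for the intervals \<open>[T - n, T]\<close> agree on common
  parts. At time \<open>t\<close> the glued function takes its value from the first interval that
  contains \<open>t\<close>.\<close>

lemma solution_exists_atMost: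
  "\<exists>V. (\<forall>a. solution a T V) \<and> (\<forall>i\<in>I. V i T = g i)"
proof -
  have "\<forall>n. \<exists>V. solution (T - real n) T V \<and> (\<forall>i\<in>I. V i T = g i)"
    using solution_exists_Icc by simp
  then obtain W where W: "\<And>n. solution (T - real n) T (W n)" "\<And>n i. i \<in> I \<Longrightarrow> W n i T = g i"
    by metis
  define V where "V i t = W (nat \<lceil>T - t\<rceil>) i t" for i t
  have V: "V i t = W n i t" if "i \<in> I" "T - real n \<le> t" "t \<le> T" for i t n
  proof -
    define k where "k = nat \<lceil>T - t\<rceil>"
    have k: "T - real k \<le> t" unfolding k_def by linarith
    have "W k i t = W n i t"
      by (rule solution_unique[OF W(1)[of k] W(1)[of n] _ that(1) k that(2,3)]) (simp add: W(2))
    then show ?thesis by (simp add: V_def k_def)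
  qed
  have "solution a T V" for a
    unfolding solution_def
  proof (intro ballI allI impI)
    fix i t assume i: "i \<in> I" and t: "a \<le> t \<and> t \<le> T"
    \<comment> \<open>The extra 1 makes \<open>W n\<close> agree with \<open>V\<close> at all times
      up to \<open>T\<close> within distance 1 of \<open>t\<close>, as transferring the derivative
      requires.\<close>
    obtain n where n: "T - t + 1 \<le> real n" using real_arch_simple by blast
    have "(W n i has_real_derivative r * W n i t - h i (\<lambda>j. W n j t - W n i t)) (at t within {..T})"
      using i t n by (intro solutionD[OF W(1)]) auto
    moreover have "h i (\<lambda>j. W n j t - W n i t) = h i (\<lambda>j. V j t - V i t)"
      using i t n nb[OF i] by (intro antisym mono) (auto simp: V[of _ n] subset_iff)
    ultimately have "(W n i has_real_derivative r * V i t - h i (\<lambda>j. V j t - V i t)) (at t within {..T})"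
      using i t n by (simp add: V[of _ n])
    then show "(V i has_real_derivative r * V i t - h i (\<lambda>j. V j t - V i t)) (at t within {..T})"
    proof (rule has_field_derivative_transform_within[where d = 1])
      fix s assume "s \<in> {..T}" "dist s t < 1"
      then show "W n i s = V i s"
        using i n V[of i n s] by (auto simp: dist_real_def)
    qed (use t in auto)
  qed
  moreover have "V i T = g i" if "i \<in> I" for i using that W(2) by (simp add: V_def)
  ultimately show ?thesis by blast
qed

end

subsection \<open>The Legendre transform of a superlinear cost\<close>

locale superlinear_cost =
  fixes J :: "nat set" and L :: "(nat \<Rightarrow> real) \<Rightarrow> ereal"
  assumes finite_J: "finite J"
    and proper: "\<exists>l\<in>nonneg_tuples J. L l < \<infinity>"
    and bounded_below: "\<exists>C::real. \<forall>l\<in>nonneg_tuples J. ereal C \<le> L l"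
    and superlinear: "((\<lambda>x. L x / ereal (sup_norm J x)) \<longlongrightarrow> \<infinity>)
      (inf (filtercomap (sup_norm J) at_top) (principal (nonneg_tuples J)))"
begin

definition legendre :: "(nat \<Rightarrow> real) \<Rightarrow> ereal" where
  "legendre p = (SUP l \<in> nonneg_tuples J. ereal (\<Sum>j\<in>J. l j * p j) - L l)"

lemma L_cases:
  assumes "l \<in> nonneg_tuples J"
  obtains x where "L l = ereal x" | "L l = \<infinity>"
  using bounded_below assms by (cases "L l") fastforce+

text \<open>Tuples of infinite cost contribute minus infinity to the supremum, so upper bounds can
  be proved in real arithmetic.\<close>

lemma legendre_le_iff:
  "legendre p \<le> ereal c \<longleftrightarrow>
    (\<forall>l\<in>nonneg_tuples J. \<forall>x. L l = ereal x \<longrightarrow> (\<Sum>j\<in>J. l j * p j) - x \<le> c)"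
proof -
  have "ereal (\<Sum>j\<in>J. l j * p j) - L l \<le> ereal c \<longleftrightarrow>
      (\<forall>x. L l = ereal x \<longrightarrow> (\<Sum>j\<in>J. l j * p j) - x \<le> c)" if "l \<in> nonneg_tuples J" for l
    using that by (cases rule: L_cases) auto
  then show ?thesis by (simp add: legendre_def SUP_le_iff)
qed

text \<open>The competing tuples have nonnegative entries, so each linear term is nondecreasing in
  \<open>p\<close>.\<close>

lemma legendre_mono:
  assumes "\<And>j. j \<in> J \<Longrightarrow> p j \<le> q j"
  shows "legendre p \<le> legendre q"
  unfolding legendre_def
proof (rule SUP_mono)
  fix l assume l: "l \<in> nonneg_tuples J"
  then have "(\<Sum>j\<in>J. l j * p j) \<le> (\<Sum>j\<in>J. l j * q j)"
    using assms by (intro sum_mono mult_left_mono) (auto simp: nonneg_tuples_def PiE_iff)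
  with l show "\<exists>m\<in>nonneg_tuples J. ereal (\<Sum>j\<in>J. l j * p j) - L l \<le> ereal (\<Sum>j\<in>J. m j * q j) - L m"
    by (intro bexI[of _ l] ereal_minus_mono) auto
qed

lemma abs_le_sup_norm: "j \<in> J \<Longrightarrow> \<bar>l j\<bar> \<le> sup_norm J l"
  unfolding sup_norm_def using finite_J by (intro Max_ge) auto

lemma sup_norm_nonneg: "0 \<le> sup_norm J l"
  unfolding sup_norm_def using finite_J by (intro Max_ge) auto

lemma abs_sum_mult_le:
  assumes "0 \<le> m" "\<And>j. j \<in> J \<Longrightarrow> \<bar>p j\<bar> \<le> m"
  shows "\<bar>\<Sum>j\<in>J. l j * p j\<bar> \<le> real (card J) * m * sup_norm J l"
proof -
  have "\<bar>\<Sum>j\<in>J. l j * p j\<bar> \<le> (\<Sum>j\<in>J. \<bar>l j * p j\<bar>)" by (rule sum_abs)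
  also have "\<dots> \<le> (\<Sum>j\<in>J. sup_norm J l * m)"
    using assms abs_le_sup_norm sup_norm_nonneg by (intro sum_mono) (auto simp: abs_mult intro!: mult_mono)
  finally show ?thesis by (simp add: algebra_simps)
qed

lemma superlinear_growth:
  "\<exists>R. \<forall>l\<in>nonneg_tuples J. \<forall>x. L l = ereal x \<longrightarrow> R < sup_norm J l \<longrightarrow> K * sup_norm J l \<le> x"
proof -
  obtain N where N: "\<And>l. N < sup_norm J l \<Longrightarrow> l \<in> nonneg_tuples J \<Longrightarrow>
      ereal K < L l / ereal (sup_norm J l)"
    using superlinear unfolding tendsto_PInfty eventually_inf_principal
      eventually_filtercomap_at_top_dense by metis
  have "K * sup_norm J l \<le> x"
    if "l \<in> nonneg_tuples J" "L l = ereal x" "max 0 N < sup_norm J l" for l x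
    using N[of l] that by (simp add: field_simps)
  then show ?thesis by blast
qed

text \<open>The linear term is at most \<open>K\<close> times the norm of the tuple. Beyond the
  threshold \<open>R\<close> the cost dominates it and leaves a value of at most 0; otherwise the
  value is at most \<open>K * R - C\<close>. A tuple of finite cost excludes minus infinity.\<close>

lemma legendre_finite: "\<bar>legendre p\<bar> \<noteq> \<infinity>"
proof -
  define m where "m = (\<Sum>j\<in>J. \<bar>p j\<bar>)"
  define K where "K = real (card J) * m"
  have m: "0 \<le> m" "\<And>j. j \<in> J \<Longrightarrow> \<bar>p j\<bar> \<le> m"
    using finite_J by (auto simp: m_def sum_nonneg intro!: member_le_sum)
  have "0 \<le> K" using m(1) by (simp add: K_def)
  obtain R where R: "\<And>l x. l \<in> nonneg_tuples J \<Longrightarrow> L l = ereal x \<Longrightarrow> R < sup_norm J l \<Longrightarrow>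
      K * sup_norm J l \<le> x"
    using superlinear_growth[of "K"] by blast
  obtain C where C: "\<And>l. l \<in> nonneg_tuples J \<Longrightarrow> ereal C \<le> L l" using bounded_below by blast
  define c where "c = max 0 (K * R - C)"
  have "legendre p \<le> ereal c"
    unfolding legendre_le_iff c_def
  proof (intro ballI allI impI)
    fix l x assume l: "l \<in> nonneg_tuples J" and x: "L l = ereal x"
    have "(\<Sum>j\<in>J. l j * p j) \<le> K * sup_norm J l"
      using abs_sum_mult_le[of m p l] m by (simp add: K_def)
    moreover have "C \<le> x" using C[OF l] x by simp
    moreover have "K * sup_norm J l \<le> K * R" if "sup_norm J l \<le> R"
      using that \<open>0 \<le> K\<close> by (rule mult_left_mono)
    ultimately show "(\<Sum>j\<in>J. l j * p j) - x \<le> max 0 (K * R - C)"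
      using R[OF l x] by linarith
  qed
  moreover have "legendre p \<noteq> - \<infinity>"
  proof -
    obtain l where l: "l \<in> nonneg_tuples J" "L l < \<infinity>" using proper by blast
    then obtain x where "L l = ereal x" by (cases rule: L_cases[OF l(1)]) auto
    then have "ereal ((\<Sum>j\<in>J. l j * p j) - x) \<le> legendre p"
      unfolding legendre_def using l by (intro SUP_upper2[of l]) auto
    then show ?thesis by auto
  qed
  ultimately show ?thesis by (cases "legendre p") auto
qed

text \<open>For arguments in a bounded set, tuples of large norm lose against a fixed tuple of finite
  cost. The supremum is thus taken over a bounded set, on which the slopes are bounded.\<close>

lemma locally_lipschitz_legendre: "locally_lipschitz_in J (\<lambda>p. real_of_ereal (legendre p))"
  unfolding locally_lipschitz_in_def
proof
  fix M :: real
  define m where "m = max 0 M"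
  define c where "c = real (card J)"
  have nonneg: "0 \<le> m" "0 \<le> c" by (auto simp: m_def c_def)
  define h where "h p = real_of_ereal (legendre p)" for p
  have h: "legendre p = ereal (h p)" for p
    using legendre_finite[of p] by (simp add: h_def ereal_real)
  have h_ge: "(\<Sum>j\<in>J. l j * p j) - x \<le> h p" if "l \<in> nonneg_tuples J" "L l = ereal x" for l x p
    using legendre_le_iff[of p "h p"] that by (auto simp: h)
  obtain l0 where l0: "l0 \<in> nonneg_tuples J" "L l0 < \<infinity>" using proper by blast
  then obtain x0 where x0: "L l0 = ereal x0" by (cases rule: L_cases[OF l0(1)]) auto
  \<comment> \<open>On the cube the linear term is at most \<open>c * m\<close> times the norm; the
    additional 1 makes the value of a large tuple at most minus its norm.\<close>
  obtain R0 where R0: "\<And>l x. l \<in> nonneg_tuples J \<Longrightarrow> L l = ereal x \<Longrightarrow> R0 < sup_norm J l \<Longrightarrow>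
      (c * m + 1) * sup_norm J l \<le> x"
    using superlinear_growth[of "c * m + 1"] by blast
  \<comment> \<open>\<open>- R\<close> lies below the value of the fixed tuple \<open>l0\<close> for
    every argument in the cube, so tuples of norm above \<open>R\<close> cannot beat
    \<open>l0\<close>.\<close>
  define R where "R = Max {0, R0, c * m * sup_norm J l0 + x0}"
  have R: "0 \<le> R" "R0 \<le> R" "c * m * sup_norm J l0 + x0 \<le> R" by (auto simp: R_def)
  have "h p \<le> h q + (c * R) * d"
    if "0 \<le> d" and pq: "\<And>j. j \<in> J \<Longrightarrow> \<bar>p j\<bar> \<le> M \<and> \<bar>q j\<bar> \<le> M \<and> \<bar>p j - q j\<bar> \<le> d" for p q d
  proof -
    have "legendre p \<le> ereal (h q + (c * R) * d)"
      unfolding legendre_le_iff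
    proof (intro ballI allI impI)
      fix l x assume l: "l \<in> nonneg_tuples J" and x: "L l = ereal x"
      show "(\<Sum>j\<in>J. l j * p j) - x \<le> h q + (c * R) * d"
      proof (cases "sup_norm J l \<le> R")
        case True
        have "(\<Sum>j\<in>J. l j * p j) - (\<Sum>j\<in>J. l j * q j) = (\<Sum>j\<in>J. l j * (p j - q j))"
          by (simp add: right_diff_distrib sum_subtractf)
        also have "\<dots> \<le> c * d * sup_norm J l"
          using abs_sum_mult_le[of d "\<lambda>j. p j - q j" l] pq \<open>0 \<le> d\<close> by (simp add: c_def)
        also have "\<dots> \<le> c * d * R"
          using True \<open>0 \<le> d\<close> nonneg by (intro mult_left_mono) auto
        finally show ?thesis using h_ge[OF l x, of q] by (simp add: algebra_simps)
      next
        case False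
        have "(\<Sum>j\<in>J. l j * p j) \<le> c * m * sup_norm J l"
          using abs_sum_mult_le[of m p l] pq by (fastforce simp: c_def m_def)
        moreover have "(c * m + 1) * sup_norm J l \<le> x" using R0[OF l x] False R(2) by simp
        ultimately have "(\<Sum>j\<in>J. l j * p j) - x \<le> - R" using False by (simp add: algebra_simps)
        also have "- R \<le> (\<Sum>j\<in>J. l0 j * q j) - x0"
          using abs_sum_mult_le[of m q l0] pq R(3) by (fastforce simp: c_def m_def)
        also have "\<dots> \<le> h q" by (rule h_ge[OF l0(1) x0])
        also have "\<dots> \<le> h q + (c * R) * d" using R(1) nonneg \<open>0 \<le> d\<close> by simp
        finally show ?thesis .
      qed
    qed
    then show ?thesis by (simp add: h)
  qed
  note le = this
  have "\<bar>h p - h q\<bar> \<le> (c * R) * d"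
    if "0 \<le> d" "\<forall>j\<in>J. \<bar>p j\<bar> \<le> M \<and> \<bar>q j\<bar> \<le> M \<and> \<bar>p j - q j\<bar> \<le> d" for p q d
    using le[of d p q] le[of d q p] that by (simp add: abs_le_iff abs_minus_commute)
  then show "\<exists>K\<ge>0. \<forall>p q d. 0 \<le> d \<longrightarrow>
      (\<forall>j\<in>J. \<bar>p j\<bar> \<le> M \<and> \<bar>q j\<bar> \<le> M \<and> \<bar>p j - q j\<bar> \<le> d) \<longrightarrow>
      \<bar>real_of_ereal (legendre p) - real_of_ereal (legendre q)\<bar> \<le> K * d"
    unfolding h_def using R(1) nonneg by (intro exI[of _ "c * R"]) auto
qed

end

subsection \<open>The Hamilton--Jacobi system\<close>

theorem theorem1:
  fixes N :: nat and G :: "(nat, 'e) pre_digraph"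
    and L :: "nat \<Rightarrow> (nat \<Rightarrow> real) \<Rightarrow> ereal"
    and T r :: real and g :: "nat \<Rightarrow> real"
  assumes "digraph G" and "strongly_connected G" and "verts G = {1..N}"
    and L_codomain: "\<forall>i\<in>{1..N}. \<forall>l\<in>nonneg_tuples (out_nbrs G i). L i l \<noteq> -\<infinity>"
    and A1: "\<forall>i\<in>{1..N}. \<exists>l\<in> (\<Pi>\<^sub>E j\<in>out_nbrs G i. {0<..}). L i l < \<infinity>"
    and A2: "\<forall>i\<in>{1..N}. lower_semicontinuous_map (nonneg_topology (out_nbrs G i)) (L i)"
    and A3: "\<exists>C::real. \<forall>i\<in>{1..N}. \<forall>l\<in>nonneg_tuples (out_nbrs G i). ereal C \<le> L i l"
    and A4: "\<forall>i\<in>{1..N}.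
      ((\<lambda>x. L i x / ereal (sup_norm (out_nbrs G i) x)) \<longlongrightarrow> \<infinity>)
        (inf (filtercomap (sup_norm (out_nbrs G i)) at_top)
             (principal (nonneg_tuples (out_nbrs G i))))"
    and "T > 0" and "r \<ge> 0"
  shows "\<exists>!V. V \<in> (\<Pi>\<^sub>E i\<in>{1..N}. {..T} \<rightarrow>\<^sub>E (UNIV :: real set)) \<and> HJ_solution G L T r g V"
proof -
  define I where "I = {1..N}"
  define h where "h i p = real_of_ereal (hamiltonian G L i p)" for i p
  interpret digraph G by fact
  have out_nbrs_subset: "out_nbrs G i \<subseteq> I" for i
    using adj_in_verts(2) assms(3) by (auto simp: out_nbrs_def I_def)
  have cost: "superlinear_cost (out_nbrs G i) (L i)" if i: "i \<in> I" for i
  proof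
    show "finite (out_nbrs G i)" using out_nbrs_subset by (rule finite_subset) (simp add: I_def)
    obtain l where "l \<in> (\<Pi>\<^sub>E j\<in>out_nbrs G i. {0<..})" "L i l < \<infinity>"
      using bspec[OF A1 i[unfolded I_def]] by (rule bexE)
    moreover from this have "l \<in> nonneg_tuples (out_nbrs G i)"
      by (auto simp: nonneg_tuples_def PiE_iff intro: less_imp_le)
    ultimately show "\<exists>l\<in>nonneg_tuples (out_nbrs G i). L i l < \<infinity>" by blast
    show "\<exists>C::real. \<forall>l\<in>nonneg_tuples (out_nbrs G i). ereal C \<le> L i l"
      using A3 i unfolding I_def by blast
  qed (use A4 i in \<open>simp add: I_def\<close>)
  have leg: "hamiltonian G L i = superlinear_cost.legendre (out_nbrs G i) (L i)" if "i \<in> I" for i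
    by (rule ext) (simp add: hamiltonian_def superlinear_cost.legendre_def[OF cost[OF that]])
  have h: "hamiltonian G L i p = ereal (h i p)" if "i \<in> I" for i p
    using superlinear_cost.legendre_finite[OF cost[OF that], of p]
    by (simp add: h_def leg[OF that] ereal_real)
  interpret monotone_system I "out_nbrs G" h r
  proof
    fix i and p q :: "nat \<Rightarrow> real"
    assume "i \<in> I" "\<And>j. j \<in> out_nbrs G i \<Longrightarrow> p j \<le> q j"
    then show "h i p \<le> h i q"
      using superlinear_cost.legendre_mono[OF cost, of i p q] h[of i p] h[of i q]
      by (simp add: leg)
  next
    show "locally_lipschitz_in (out_nbrs G i) (h i)" if "i \<in> I" for i
      using superlinear_cost.locally_lipschitz_legendre[OF cost[OF that]]
      by (simp add: h_def[abs_def] leg[OF that])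
  qed (use out_nbrs_subset \<open>r \<ge> 0\<close> in \<open>auto simp: I_def\<close>)
  \<comment> \<open>The tuple in \<open>HJ_solution\<close> is \<open>undefined\<close> off the
    neighbours, but \<open>h i\<close> does not read those coordinates.\<close>
  have h_restrict: "h i (\<lambda>j\<in>out_nbrs G i. p j) = h i p" if "i \<in> I" for i p
    using that by (intro antisym mono) auto
  \<comment> \<open>Since the Hamiltonians are finite, the extended-real equation can be solved for
    the derivative.\<close>
  have HJ: "HJ_solution G L T r g V \<longleftrightarrow> (\<forall>a. solution a T V) \<and> (\<forall>i\<in>I. V i T = g i)" for V
  proof
    assume HJ: "HJ_solution G L T r g V"
    have "(V i has_real_derivative r * V i t - h i (\<lambda>j. V j t - V i t)) (at t within {..T})"
      if "i \<in> I" "t \<le> T" for i t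
    proof -
      have "i \<in> verts G" using that assms(3) by (simp add: I_def)
      with HJ obtain D where "\<forall>t\<le>T. (V i has_real_derivative D t) (at t within {..T}) \<and>
          ereal (D t - r * V i t) + hamiltonian G L i (\<lambda>j\<in>out_nbrs G i. V j t - V i t) = 0"
        unfolding HJ_solution_def by blast
      with that(2) have D: "(V i has_real_derivative D t) (at t within {..T})"
        "ereal (D t - r * V i t) + hamiltonian G L i (\<lambda>j\<in>out_nbrs G i. V j t - V i t) = 0"
        by auto
      have "D t = r * V i t - h i (\<lambda>j. V j t - V i t)"
        using D(2) unfolding h[OF that(1)] h_restrict[OF that(1)] by (simp add: zero_ereal_def)
      with D(1) show ?thesis by simp
    qed
    then have "\<forall>a. solution a T V" unfolding solution_def by blast
    moreover have "\<forall>i\<in>I. V i T = g i" using HJ by (simp add: HJ_solution_def I_def assms(3))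
    ultimately show "(\<forall>a. solution a T V) \<and> (\<forall>i\<in>I. V i T = g i)" ..
  next
    assume V: "(\<forall>a. solution a T V) \<and> (\<forall>i\<in>I. V i T = g i)"
    have deriv: "(V i has_real_derivative r * V i t - h i (\<lambda>j. V j t - V i t)) (at t within {..T})"
      if "i \<in> I" "t \<le> T" for i t
      using V that solutionD[of t T V i t] by blast
    \<comment> \<open>Continuity of the derivative comes from the equation itself: a differentiable
      solution is continuous, hence so is the right-hand side.\<close>
    have cont: "continuous_on {..T} (V i)" if "i \<in> I" for i
      using deriv[OF that] by (intro DERIV_continuous_on) auto
    have "continuous_on {..T} (\<lambda>t. h i (\<lambda>j. V j t - V i t))" if i: "i \<in> I" for i
    proof (rule continuous_on_locally_lipschitz_in[where J = "out_nbrs G i" and F = "h i" and x = "\<lambda>j t. V j t - V i t"])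
      show "finite (out_nbrs G i)" using out_nbrs_subset finite_I by (rule finite_subset)
    qed (use locally_lipschitz cont i out_nbrs_subset in \<open>auto intro!: continuous_intros\<close>)
    then have "continuous_on {..T} (\<lambda>t. r * V i t - h i (\<lambda>j. V j t - V i t))" if "i \<in> I" for i
      using cont that by (intro continuous_intros) auto
    with V deriv show "HJ_solution G L T r g V"
      unfolding HJ_solution_def assms(3) I_def[symmetric]
      by (auto intro!: exI[of _ "\<lambda>t. r * V _ t - h _ (\<lambda>j. V j t - V _ t)"] simp: h h_restrict zero_ereal_def)
  qed
  obtain V where V: "\<And>a. solution a T V" "\<And>i. i \<in> I \<Longrightarrow> V i T = g i"
    using solution_exists_atMost by blast
  \<comment> \<open>Uniqueness is claimed among functions that are \<open>undefined\<close> outside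
    the nodes and outside \<open>{..T}\<close>; the restriction does not affect derivatives within
    \<open>{..T}\<close>.\<close>
  define U where "U = (\<lambda>i\<in>I. \<lambda>t\<in>{..T}. V i t)"
  have U: "U i t = V i t" if "i \<in> I" "t \<le> T" for i t using that by (simp add: U_def)
  have "solution a T U" for a
    unfolding solution_def
  proof (intro ballI allI impI)
    fix i t assume i: "i \<in> I" and t: "a \<le> t \<and> t \<le> T"
    have "h i (\<lambda>j. U j t - U i t) = h i (\<lambda>j. V j t - V i t)"
      using i t out_nbrs_subset by (intro antisym mono) (auto simp: U subset_iff)
    then have "(V i has_real_derivative r * U i t - h i (\<lambda>j. U j t - U i t)) (at t within {..T})"
      using solutionD[OF V(1)[of a] i] t i by (simp add: U)
    then show "(U i has_real_derivative r * U i t - h i (\<lambda>j. U j t - U i t)) (at t within {..T})"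
      by (rule has_field_derivative_transform_within[where d = 1]) (use i t in \<open>auto simp: U\<close>)
  qed
  then have U_HJ: "HJ_solution G L T r g U" using V(2) by (simp add: HJ U)
  have U_PiE: "U \<in> (\<Pi>\<^sub>E i\<in>{1..N}. {..T} \<rightarrow>\<^sub>E UNIV)"
    by (auto simp: U_def I_def)
  have unique: "W = U" if W: "W \<in> (\<Pi>\<^sub>E i\<in>{1..N}. {..T} \<rightarrow>\<^sub>E UNIV)" "HJ_solution G L T r g W" for W
  proof (rule PiE_ext[OF W(1) U_PiE])
    fix i assume i: "i \<in> {1..N}"
    show "W i = U i"
    proof (rule PiE_ext[OF PiE_mem[OF W(1) i] PiE_mem[OF U_PiE i]])
      fix t assume "t \<in> {..T}"
      then have "t \<le> T" by simp
      \<comment> \<open>Starting the interval at \<open>t\<close> itself lets uniqueness on bounded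
        intervals cover every time.\<close>
      have "solution t T W" "solution t T U" "\<And>j. j \<in> I \<Longrightarrow> W j T = U j T"
        using W(2) U_HJ by (simp_all add: HJ)
      then show "W i t = U i t"
        by (rule solution_unique) (use i \<open>t \<le> T\<close> in \<open>simp_all add: I_def\<close>)
    qed
  qed
  show ?thesis
    by (rule ex1I, rule conjI[OF U_PiE U_HJ], erule conjE, rule unique)
qed

end
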